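(* Let $\mathcal{A}$ be a finite alphabet with $|\mathcal{A}|\ge 2$ and let $\mathcal{A}^*$ be the free monoid generated by $\mathcal{A}$, under concatenation. For $w\in\mathcal{A}^*$ let $f_w:\mathcal{A}^*\to\mathbb{C}$, $f_w(x)=[x]_w$, be the subword counting function of $w$. Then $$\mathcal{P}(\mathcal{A}^*,\mathbb{C})=\operatorname{span}_{\mathbb{C}}\{f_w : w\in\mathcal{A}^*\}.$$ Moreover, $\operatorname{fdeg}(f_w)=|w|$ for each $w\in\mathcal{A}^*$.
   Context: Let $(S,\cdot,e)$ be a monoid and $(G,+,0)$ a commutative group. For $s\in S$ define operators on functions $f:S\to G$ by $L_s(f)(t)=f(st)-f(t)$ and $R_s(f)(t)=f(ts)-f(t)$. Polynomial maps and functional degree are defined inductively: constant functions are polynomial maps; the constant $0$ has functional degree $-\infty$, nonzero constants have functional degree $0$ (so the maps of functional degree $\le 0$ are exactly the constants). For $n\ge 1$, $f:S\to G$ is a polynomial map of functional degree $\le n$ if and only if for each $s\in S$ both $R_s(f)$ and $L_s(f)$ are polynomial maps of functional degree $\le n-1$. The minimal such $n$ is the functional degree $\operatorname{fdeg}(f)$. $\mathcal{P}_n(S,G)$ is the set of polynomial maps $f:S\to G$ with functional degree $\le n$, and $\mathcal{P}(S,G)=\bigcup_{n\ge0}\mathcal{P}_n(S,G)$. Here $G=(\mathbb{C},+)$. For words $x=x_1\cdots x_m$ and $w=w_1\cdots w_d$ in $\mathcal{A}^*$, $[x]_w$ is the number of times $w$ occurs as a scattered subword of $x$, i.e. the number of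 index tuples $1\le i_1<\dots<i_d\le m$ with $x_{i_k}=w_k$ for all $k$. For the empty word $\epsilon$, $[x]_\epsilon=1$ for all $x$. $|w|$ denotes the length of $w$. *)

theory Defs
  imports Complex_Main "HOL-Library.Function_Algebras" "HOL-Library.Extended" "HOL-Library.Cardinality"
begin

text \<open>The locale \<^locale>\<open>monoid\<close> supplies a monoid whose carrier is a whole type
  \<open>'a\<close>, with operation \<open>\<^bold>*\<close>.\<close>

context monoid
begin

definition left_diff :: "'a \<Rightarrow> ('a \<Rightarrow> 'g::ab_group_add) \<Rightarrow> 'a \<Rightarrow> 'g"
  where "left_diff s h = (\<lambda>t. h (s \<^bold>* t) - h t)"

definition right_diff :: "'a \<Rightarrow> ('a \<Rightarrow> 'g::ab_group_add) \<Rightarrow> 'a \<Rightarrow> 'g"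
  where "right_diff s h = (\<lambda>t. h (t \<^bold>* s) - h t)"

primrec poly_map_le :: "nat \<Rightarrow> ('a \<Rightarrow> 'g::ab_group_add) \<Rightarrow> bool"
  where
    "poly_map_le 0 h \<longleftrightarrow> (\<exists>c. h = (\<lambda>_. c))"
  | "poly_map_le (Suc n) h \<longleftrightarrow>
       (\<forall>s. poly_map_le n (right_diff s h) \<and> poly_map_le n (left_diff s h))"

definition poly_maps_le :: "nat \<Rightarrow> ('a \<Rightarrow> 'g::ab_group_add) set"
  where "poly_maps_le n = {h. poly_map_le n h}"

definition poly_maps :: "('a \<Rightarrow> 'g::ab_group_add) set"
  where "poly_maps = (\<Union>n. poly_maps_le n)"

text \<open>Maps that are not polynomial get the functional degree \<^term>\<open>Pinf\<close>; the zero map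
  has functional degree \<^term>\<open>Minf\<close>, that is, minus infinity.\<close>

definition fdeg :: "('a \<Rightarrow> 'g::ab_group_add) \<Rightarrow> nat extended"
  where "fdeg h =
    (if h = (\<lambda>_. 0) then Minf
     else if h \<in> poly_maps then Fin (LEAST n. h \<in> poly_maps_le n)
     else Pinf)"

end

text \<open>The free monoid on \<open>'a\<close> is \<open>'a list\<close> under concatenation. The library already
  interprets \<^locale>\<open>monoid\<close> for it with prefix \<open>append\<close>, so the notions above are available
  as \<open>append.poly_maps\<close>, \<open>append.fdeg\<close>, and so on.\<close>

text \<open>Index tuples are represented as lists of 0-based positions.\<close>

definition subword_occs :: "'a list \<Rightarrow> 'a list \<Rightarrow> nat list set"
  where "subword_occs x w =
    {js. length js = length w \<and> sorted_wrt (<) js \<and>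
         (\<forall>k<length w. js ! k < length x \<and> x ! (js ! k) = w ! k)}"

definition subword_count :: "'a list \<Rightarrow> 'a list \<Rightarrow> nat"
  where "subword_count x w = card (subword_occs x w)"

definition subword_fun :: "'a list \<Rightarrow> 'a list \<Rightarrow> complex"
  where "subword_fun w = (\<lambda>x. of_nat (subword_count x w))"

definition fun_scale :: "complex \<Rightarrow> ('s \<Rightarrow> complex) \<Rightarrow> 's \<Rightarrow> complex"
  where "fun_scale c h = (\<lambda>x. c * h x)"

global_interpretation complex_fun: vector_space fun_scale
  by unfold_locales (auto simp: fun_scale_def fun_eq_iff algebra_simps)

end

theory Submission
  imports Defs
begin

text \<open>Splitting the occurrences of \<open>w\<close> in a product \<open>x @ y\<close> according to how much of \<open>w\<close> lies in
  \<open>x\<close> shows that differences of \<open>f\<^sub>w\<close> are combinations of \<open>f\<^sub>v\<close> with \<open>v\<close> strictly shorter than \<open>w\<close>,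
  so \<open>f\<^sub>w\<close> has degree at most \<open>|w|\<close>. For letters \<open>a\<close>, \<open>b\<close> the left difference of \<open>f\<^bsub>bw\<^esub>\<close> by \<open>a\<close> is
  \<open>f\<^sub>w\<close> if \<open>a = b\<close> and \<open>0\<close> otherwise. Hence degrees cannot be smaller than claimed, and every
  polynomial map can be reconstructed, up to a constant, from its left differences by letters,
  which by induction on the degree are combinations of subword counting functions.\<close>

section \<open>Vector space structure of complex polynomial maps\<close>

context monoid
begin

lemma left_diff_add: "left_diff s (g + h) = left_diff s g + left_diff s h"
  by (simp add: left_diff_def fun_eq_iff algebra_simps)

lemma right_diff_add: "right_diff s (g + h) = right_diff s g + right_diff s h"
  by (simp add: right_diff_def fun_eq_iff algebra_simps)

lemma left_diff_fun_scale: "left_diff s (fun_scale c h) = fun_scale c (left_diff s h)"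
  by (simp add: left_diff_def fun_scale_def fun_eq_iff algebra_simps)

lemma right_diff_fun_scale: "right_diff s (fun_scale c h) = fun_scale c (right_diff s h)"
  by (simp add: right_diff_def fun_scale_def fun_eq_iff algebra_simps)

lemma poly_map_le_const: "poly_map_le n (\<lambda>_. c)"
proof (induction n arbitrary: c)
  case (Suc n)
  then show ?case
    by (simp add: left_diff_def right_diff_def)
qed auto

lemma poly_map_le_add:
  "poly_map_le n g \<Longrightarrow> poly_map_le n h \<Longrightarrow> poly_map_le n (g + h)"
proof (induction n arbitrary: g h)
  case 0
  then show ?case
    by (auto simp: fun_eq_iff)
next
  case (Suc n)
  then show ?case
    unfolding poly_map_le.simps left_diff_add right_diff_add by blast
qed

lemma poly_map_le_fun_scale: "poly_map_le n h \<Longrightarrow> poly_map_le n (fun_scale c h)"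
proof (induction n arbitrary: h)
  case 0
  then show ?case
    by (auto simp: fun_scale_def)
next
  case (Suc n)
  then show ?case
    by (simp add: left_diff_fun_scale right_diff_fun_scale)
qed

lemma poly_map_le_Suc: "poly_map_le n h \<Longrightarrow> poly_map_le (Suc n) h"
proof (induction n arbitrary: h)
  case 0
  then show ?case
    by (auto simp: left_diff_def right_diff_def)
next
  case (Suc n)
  then show ?case
    by (metis poly_map_le.simps(2))
qed

lemma poly_map_le_mono: "m \<le> n \<Longrightarrow> poly_map_le m h \<Longrightarrow> poly_map_le n h"
  by (induction n rule: dec_induct) (auto intro: poly_map_le_Suc simp del: poly_map_le.simps(2))

lemma subspace_poly_maps_le: "complex_fun.subspace (poly_maps_le n)"
  unfolding complex_fun.subspace_def poly_maps_le_def
  using poly_map_le_const[of n 0]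
  by (auto intro: poly_map_le_add poly_map_le_fun_scale simp: zero_fun_def)

text \<open>The degree filtration is increasing, so two polynomial maps lie in a common
  \<open>poly_maps_le\<close> level, that of the larger bound, which is a subspace.\<close>

lemma subspace_poly_maps: "complex_fun.subspace poly_maps"
  unfolding complex_fun.subspace_def
proof (intro conjI ballI allI)
  show "(0 :: 'a \<Rightarrow> complex) \<in> poly_maps"
    using complex_fun.subspace_0[OF subspace_poly_maps_le] by (auto simp: poly_maps_def)
next
  fix g h :: "'a \<Rightarrow> complex" assume "g \<in> poly_maps" "h \<in> poly_maps"
  then obtain m n where "poly_map_le m g" "poly_map_le n h"
    by (auto simp: poly_maps_def poly_maps_le_def)
  then have "poly_map_le (max m n) (g + h)"
    by (intro poly_map_le_add; elim poly_map_le_mono[rotated]; simp)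
  then show "g + h \<in> poly_maps"
    by (auto simp: poly_maps_def poly_maps_le_def)
next
  fix c and h :: "'a \<Rightarrow> complex" assume "h \<in> poly_maps"
  then show "fun_scale c h \<in> poly_maps"
    by (auto simp: poly_maps_def poly_maps_le_def intro: poly_map_le_fun_scale)
qed

end

lemma sum_fun_apply: "(\<Sum>i\<in>I. f i) x = (\<Sum>i\<in>I. f i x)"
  by (induction I rule: infinite_finite_induct) simp_all

section \<open>Recursion and product formula for subword counts\<close>

lemma subword_occs_Nil [simp]: "subword_occs x [] = {[]}"
  by (auto simp: subword_occs_def)

lemma subword_occs_Nil_Cons [simp]: "subword_occs [] (b # w) = {}"
  by (auto simp: subword_occs_def)

lemma Cons_mem_subword_occs_Cons:
  "j # js \<in> subword_occs x (b # w) \<longleftrightarrow>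
     j < length x \<and> x ! j = b \<and> (\<forall>i\<in>set js. j < i) \<and> js \<in> subword_occs x w"
  by (auto simp: subword_occs_def nth_Cons split: nat.splits)

lemma map_Suc_mem_subword_occs_Cons:
  "map Suc js \<in> subword_occs (a # x) w \<longleftrightarrow> js \<in> subword_occs x w"
  by (auto simp: subword_occs_def sorted_wrt_map)

lemma positive_list_eq_map_Suc: "\<forall>i\<in>set js. 0 < i \<Longrightarrow> \<exists>is. js = map Suc is"
  by (rule exI[of _ "map (\<lambda>i. i - 1) js"]) (simp add: map_idI)

text \<open>An occurrence either avoids position 0, and is then a shifted occurrence in
  \<open>x\<close>, or starts there, which forces \<open>a = b\<close> and leaves a shifted
  occurrence of \<open>w\<close> in \<open>x\<close>.\<close>

lemma subword_occs_Cons_Cons: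
  "subword_occs (a # x) (b # w) =
     map Suc ` subword_occs x (b # w) \<union>
     (if a = b then (\<lambda>js. 0 # map Suc js) ` subword_occs x w else {})" (is "?L = ?R")
proof (intro set_eqI iffI)
  fix js assume js: "js \<in> ?L"
  then obtain k ks where [simp]: "js = k # ks"
    by (cases js) (auto simp: subword_occs_def)
  have less: "\<forall>i\<in>set ks. k < i"
    using js by (simp add: Cons_mem_subword_occs_Cons)
  show "js \<in> ?R"
  proof (cases k)
    case 0
    then obtain "is" where "ks = map Suc is"
      using less positive_list_eq_map_Suc by auto
    then show ?thesis
      using js 0 by (auto simp: Cons_mem_subword_occs_Cons map_Suc_mem_subword_occs_Cons)
  next
    case (Suc l)
    then have "\<forall>i\<in>set js. 0 < i"
      using less by auto
    then obtain "is" where "js = map Suc is"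
      using positive_list_eq_map_Suc by blast
    then show ?thesis
      using js by (simp only: map_Suc_mem_subword_occs_Cons) simp
  qed
next
  fix js assume "js \<in> ?R"
  then show "js \<in> ?L"
    by (auto simp: map_Suc_mem_subword_occs_Cons Cons_mem_subword_occs_Cons split: if_splits)
qed

lemma finite_subword_occs [simp]: "finite (subword_occs x w)"
proof (rule finite_subset)
  show "subword_occs x w \<subseteq> {js. set js \<subseteq> {..<length x} \<and> length js = length w}"
    by (auto simp: subword_occs_def in_set_conv_nth)
  show "finite {js. set js \<subseteq> {..<length x} \<and> length js = length w}"
    by (rule finite_lists_length_eq) simp
qed

lemma subword_count_Nil [simp]: "subword_count x [] = 1"
  by (simp add: subword_count_def)

lemma subword_count_Nil_Cons [simp]: "subword_count [] (b # w) = 0"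
  by (simp add: subword_count_def)

lemma subword_count_Cons_Cons [simp]:
  "subword_count (a # x) (b # w) =
     subword_count x (b # w) + (if a = b then subword_count x w else 0)"
proof -
  have "card (map Suc ` subword_occs x v) = card (subword_occs x v)" for v
    by (rule card_image) (simp add: inj_on_def)
  moreover have "card ((\<lambda>js. 0 # map Suc js) ` subword_occs x w) = card (subword_occs x w)"
    by (rule card_image) (simp add: inj_on_def)
  moreover have "map Suc ` subword_occs x (b # w) \<inter> (\<lambda>js. 0 # map Suc js) ` subword_occs x w = {}"
    by auto
  ultimately show ?thesis
    by (simp add: subword_count_def subword_occs_Cons_Cons card_Un_disjoint)
qed

text \<open>Each occurrence is cut at the boundary between \<open>x\<close> and \<open>y\<close>: a
  prefix of \<open>w\<close> of some length \<open>k\<close> lies in \<open>x\<close>, the rest in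
  \<open>y\<close>. The induction on \<open>x\<close> obtains this from the letter recursion,
  without an explicit bijection.\<close>

lemma subword_count_append:
  "subword_count (x @ y) w =
     (\<Sum>k\<le>length w. subword_count x (take k w) * subword_count y (drop k w))"
proof (induction x arbitrary: w)
  case Nil
  show ?case
    by (cases w) (simp_all add: sum.atMost_Suc_shift del: sum.atMost_Suc)
next
  case (Cons a x)
  show ?case
    \<comment> \<open>The recursion needs a nonempty pattern, so for nonempty \<open>w\<close> the
      summand \<open>k = 0\<close>, where all of \<open>w\<close> lies in \<open>y\<close>, is split
      off by an index shift.\<close>
    by (cases w)
      (simp_all add: Cons.IH sum.atMost_Suc_shift sum.distrib distrib_right del: sum.atMost_Suc)
qed

lemma subword_count_self_pos: "subword_count w w > 0"
  by (induction w) simp_all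

section \<open>Differences and degrees of subword counting functions\<close>

lemma subword_fun_Nil: "subword_fun [] = (\<lambda>_. 1)"
  by (simp add: subword_fun_def)

text \<open>In the product formula for \<open>s @ t\<close> the summand \<open>k = 0\<close> is
  \<open>subword_fun w t\<close> and cancels; every remaining suffix \<open>drop k w\<close> is
  strictly shorter than \<open>w\<close>.\<close>

lemma left_diff_subword_fun:
  "append.left_diff s (subword_fun w) =
     (\<Sum>k\<in>{1..length w}. fun_scale (of_nat (subword_count s (take k w))) (subword_fun (drop k w)))"
proof
  fix t
  have "{..length w} = insert 0 {1..length w}"
    by auto
  then show "append.left_diff s (subword_fun w) t = (\<Sum>k\<in>{1..length w}.
      fun_scale (of_nat (subword_count s (take k w))) (subword_fun (drop k w))) t"
    by (simp add: append.left_diff_def subword_fun_def subword_count_append fun_scale_def sum_fun_apply)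
qed

text \<open>Here \<open>s\<close> is the second factor, so the cancelling summand is
  \<open>k = length w\<close> and proper prefixes of \<open>w\<close> remain.\<close>

lemma right_diff_subword_fun:
  "append.right_diff s (subword_fun w) =
     (\<Sum>k<length w. fun_scale (of_nat (subword_count s (drop k w))) (subword_fun (take k w)))"
proof
  fix t
  have "{..length w} = insert (length w) {..<length w}"
    by auto
  then show "append.right_diff s (subword_fun w) t = (\<Sum>k<length w.
      fun_scale (of_nat (subword_count s (drop k w))) (subword_fun (take k w))) t"
    by (simp add: append.right_diff_def subword_fun_def subword_count_append fun_scale_def
        sum_fun_apply mult.commute)
qed

lemma left_diff_letter_subword_fun:
  "append.left_diff [a] (subword_fun (b # w)) = (if a = b then subword_fun w else 0)"
  by (simp add: append.left_diff_def subword_fun_def fun_eq_iff)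

lemma poly_map_le_subword_fun: "length w \<le> n \<Longrightarrow> append.poly_map_le n (subword_fun w)"
proof (induction n arbitrary: w)
  case 0
  then show ?case
    by (auto simp: subword_fun_Nil)
next
  case (Suc n)
  have *: "subword_fun v \<in> append.poly_maps_le n" if "length v \<le> n" for v :: "'a list"
    using Suc.IH[OF that] by (simp add: append.poly_maps_le_def)
  note subspace = append.subspace_poly_maps_le[of n]
  have "append.left_diff s (subword_fun w) \<in> append.poly_maps_le n" for s
    unfolding left_diff_subword_fun using Suc.prems
    by (intro complex_fun.subspace_sum[OF subspace] complex_fun.subspace_scale[OF subspace] *) auto
  moreover have "append.right_diff s (subword_fun w) \<in> append.poly_maps_le n" for s
    unfolding right_diff_subword_fun using Suc.prems
    by (intro complex_fun.subspace_sum[OF subspace] complex_fun.subspace_scale[OF subspace] *) auto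
  ultimately show ?case
    by (simp add: append.poly_maps_le_def)
qed

text \<open>Each left difference by the first letter of the word removes that letter and lowers the
  degree bound by one, so the bound cannot run out before the word does.\<close>

lemma length_le_if_poly_map_le_subword_fun:
  "append.poly_map_le n (subword_fun w) \<Longrightarrow> length w \<le> n"
proof (induction n arbitrary: w)
  case 0
  \<comment> \<open>A constant function agrees at \<open>[]\<close> and \<open>w\<close>, but a
    nonempty \<open>w\<close> occurs in itself and not in \<open>[]\<close>.\<close>
  then have "subword_fun w [] = subword_fun w w"
    by auto
  then have "subword_count [] w = subword_count w w"
    by (simp only: subword_fun_def of_nat_eq_iff)
  then show ?case
    using subword_count_self_pos[of w] by (cases w) simp_all
next
  case (Suc n)
  show ?case
  proof (cases w)
    case (Cons a v)
    have "append.poly_map_le n (append.left_diff [a] (subword_fun w))"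
      using Suc.prems by simp
    then show ?thesis
      using Suc.IH Cons by (simp add: left_diff_letter_subword_fun)
  qed simp
qed

lemma fdeg_subword_fun: "append.fdeg (subword_fun w) = Fin (length w)"
proof -
  have "subword_fun w w \<noteq> 0"
    using subword_count_self_pos[of w] by (simp add: subword_fun_def)
  then have "subword_fun w \<noteq> (\<lambda>_. 0)"
    by metis
  moreover have iff: "subword_fun w \<in> append.poly_maps_le n \<longleftrightarrow> length w \<le> n" for n
    using poly_map_le_subword_fun length_le_if_poly_map_le_subword_fun
    by (auto simp: append.poly_maps_le_def)
  moreover have "(LEAST n. subword_fun w \<in> append.poly_maps_le n) = length w"
    unfolding iff by (rule Least_equality) auto
  ultimately show ?thesis
    by (auto simp: append.fdeg_def append.poly_maps_def)
qed

section \<open>Reconstruction from left differences by letters\<close>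

abbreviation subword_span :: "('a list \<Rightarrow> complex) set"
  where "subword_span \<equiv> complex_fun.span (range subword_fun)"

text \<open>\<open>H\<close> acts as a partial primitive of \<open>h\<close> in direction
  \<open>b\<close>. It arises by linearly extending the map that prepends \<open>b\<close> to words,
  so differences in all other letters vanish.\<close>

lemma left_diff_letter_primitive:
  assumes "h \<in> subword_span"
  shows "\<exists>H\<in>subword_span. \<forall>a. append.left_diff [a] H = (if a = b then h else 0)"
  using assms
proof (induction rule: complex_fun.span_induct_alt)
  case base
  show ?case
    by (rule bexI[OF _ complex_fun.span_zero]) (simp add: append.left_diff_def fun_eq_iff)
next
  case (step c g h)
  then obtain w H where w: "g = subword_fun w" and H: "H \<in> subword_span"
    "\<And>a. append.left_diff [a] H = (if a = b then h else 0)"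
    by blast
  have "fun_scale c (subword_fun (b # w)) + H \<in> subword_span"
    using H by (simp add: complex_fun.span_add complex_fun.span_scale complex_fun.span_base)
  moreover have "append.left_diff [a] (fun_scale c (subword_fun (b # w)) + H) =
      (if a = b then fun_scale c g + h else 0)" for a
    by (simp add: append.left_diff_add append.left_diff_fun_scale H
        left_diff_letter_subword_fun w)
  ultimately show ?case
    by blast
qed

text \<open>The hypothesis lets letters be removed from the front of \<open>x\<close> one at a time
  without changing the value.\<close>

lemma const_if_left_diff_letters_eq_0:
  assumes "\<And>a. append.left_diff [a] h = 0"
  shows "h x = h []"
proof (induction x)
  case (Cons a x)
  then show ?case
    using fun_cong[OF assms[of a], of x] by (simp add: append.left_diff_def)
qed simp

lemma poly_map_le_in_span:
  fixes h :: "'a::finite list \<Rightarrow> complex"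
  assumes "append.poly_map_le n h"
  shows "h \<in> subword_span"
  using assms
proof (induction n arbitrary: h)
  case 0
  then obtain c where "h = (\<lambda>_. c)"
    by auto
  then have "h = fun_scale c (subword_fun [])"
    by (simp add: subword_fun_Nil fun_scale_def)
  then show ?case
    by (simp add: complex_fun.span_base complex_fun.span_scale)
next
  case (Suc n)
  have "append.left_diff [b] h \<in> subword_span" for b
    using Suc by simp
  then have "\<forall>b. \<exists>H\<in>subword_span.
      \<forall>a. append.left_diff [a] H = (if a = b then append.left_diff [b] h else 0)"
    by (intro allI left_diff_letter_primitive)
  then obtain H where H: "\<And>b. H b \<in> subword_span"
    "\<And>a b. append.left_diff [a] (H b) = (if a = b then append.left_diff [b] h else 0)"
    unfolding Bex_def choice_iff by blast
  \<comment> \<open>Subtracting one primitive per letter, a finite sum since the alphabet is finite,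
    cancels every left difference of \<open>h\<close> by a letter, so \<open>g\<close> will be
    constant.\<close>
  define g where "g = h - (\<Sum>b\<in>UNIV. H b)"
  have "append.left_diff [a] g = 0" for a
  proof
    fix t
    have "append.left_diff [a] g t =
        append.left_diff [a] h t - (\<Sum>b\<in>UNIV. append.left_diff [a] (H b) t)"
      by (simp add: g_def append.left_diff_def sum_fun_apply sum_subtractf)
    also have "(\<Sum>b\<in>UNIV. append.left_diff [a] (H b) t) =
        (\<Sum>b\<in>UNIV. if a = b then append.left_diff [b] h t else 0)"
      by (intro sum.cong) (simp_all add: H)
    finally show "append.left_diff [a] g t = 0 t"
      by simp
  qed
  then have "g x = g []" for x
    by (rule const_if_left_diff_letters_eq_0)
  then have "g = fun_scale (g []) (subword_fun [])"
    by (auto simp: subword_fun_Nil fun_scale_def)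
  then have "g \<in> subword_span"
    by (metis complex_fun.span_base complex_fun.span_scale rangeI)
  moreover have "h = g + (\<Sum>b\<in>UNIV. H b)"
    by (simp add: g_def)
  ultimately show ?case
    by (metis H(1) complex_fun.span_add complex_fun.span_sum)
qed

theorem theorem3p1:
  assumes "CARD('a::finite) \<ge> 2"
  shows "(append.poly_maps :: ('a list \<Rightarrow> complex) set) =
           complex_fun.span {subword_fun w | w :: 'a list. True} \<and>
         (\<forall>w :: 'a list. append.fdeg (subword_fun w) = Fin (length w))"
proof -
  have range: "{subword_fun w | w :: 'a list. True} = range subword_fun"
    by auto
  have "(append.poly_maps :: ('a list \<Rightarrow> complex) set) \<subseteq> subword_span"
    using poly_map_le_in_span by (auto simp: append.poly_maps_def append.poly_maps_le_def)
  \<comment> \<open>The span is the least subspace containing the generators, each of which is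
    polynomial.\<close>
  moreover have "subword_span \<subseteq> (append.poly_maps :: ('a list \<Rightarrow> complex) set)"
    using poly_map_le_subword_fun
    by (intro complex_fun.span_minimal append.subspace_poly_maps)
      (auto simp: append.poly_maps_def append.poly_maps_le_def)
  ultimately show ?thesis
    unfolding range using fdeg_subword_fun by blast
qed

end
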